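(* Let $\mathcal{X}\subset\mathbb{R}^n$ and $\mathcal{U}\subset\mathbb{R}^m$ be nonempty compact sets, let $\mathbb{P}$ be a probability distribution supported on $\mathcal{U}$, and let $\alpha\in(0,1)$. Assume that, for all $i\in\{1,\dots,n\}$, the random functions have the form $$f_i(x,u)=\tilde f_i(x)\,g_i(u)+\check f_i(x),\qquad x\in\mathcal{X},\ u\in\mathcal{U},$$ where $\tilde f_i$, $g_i$ and $\check f_i$ are non-negative real-valued continuous functions. Let $F$ be the map with components $F_i(x)=\mathrm{CVaR}^{\mathbb{P}}_\alpha[f_i(x,u)]$, and for $N$ i.i.d. samples $\hat u^1,\dots,\hat u^N$ from $\mathbb{P}$ let $\hat F^N$ be the map with components $\hat F^N_i(x)=\widehat{\mathrm{CVaR}}^N_\alpha[f_i(x,u)]$. Let $\mathcal{S}=\mathrm{SOL}(\mathcal{X},F)$ and $\hat{\mathcal{S}}^N=\mathrm{SOL}(\mathcal{X},\hat F^N)$. Let $\delta:\mathbb{R}_{>0}\to\mathbb{R}_{>0}$ be a map such that, for every $\epsilon>0$, one has $\mathbb{D}(\hat{\mathcal{S}}^N,\mathcal{S})\le\epsilon$ whenever $\sup_{x\in\mathcal{X}}\|\hat F^N(x)-F(x)\|\le\delta(\epsilon)$ (for every $N$ and every sample realization). Then for any $\epsilon>0$ and $N\in\mathbb{N}$, $$\mathbb{P}^N\bigl(\mathbb{D}(\hat{\mathcal{S}}^N,\mathcal{S})\le\epsilon\bigr)\ge 1-6n\,e^{-\beta(\delta(\epsilon))N},\qquad\text{where }\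 \beta(\eta)=\frac{\alpha\eta^2}{11\,n\,(f^{\max}g^{\mathrm{rge}})^2}\ \ (\eta>0),$$ with $f^{\max}=\sup_{1\le i\le n,\,x\in\mathcal{X}}\tilde f_i(x)$ and $g^{\mathrm{rge}}=\sup_{1\le i\le n}\bigl(\sup_{u\in\mathcal{U}}g_i(u)-\inf_{u\in\mathcal{U}}g_i(u)\bigr)$.
   Context: Notation: $[v]_+=\max\{0,v\}$; $\|\cdot\|$ is the Euclidean norm; $\mathbb{P}^N$ is the law of the $N$ i.i.d. samples. CVaR: $\mathrm{CVaR}_\alpha^{\mathbb{P}}[f_i(x,u)]=\inf_{t\in\mathbb{R}}\{t+\frac1\alpha\mathbb{E}_{\mathbb{P}}[f_i(x,u)-t]_+\}$. Empirical CVaR: $\widehat{\mathrm{CVaR}}^N_\alpha[f_i(x,u)]=\inf_{t\in\mathbb{R}}\{t+\frac1{N\alpha}\sum_{j=1}^N[f_i(x,\hat u^j)-t]_+\}$. Variational inequality: for a map $G:\mathcal{X}\to\mathbb{R}^n$, $\mathrm{SOL}(\mathcal{X},G)$ is the set of $x^*\in\mathcal{X}$ such that $(x-x^* )^\top G(x^* )\ge 0$ for all $x\in\mathcal{X}$. Deviation of sets: $\mathbb{D}(\mathcal{A},\mathcal{B})=\sup_{y\in\mathcal{A}}\mathrm{dist}(y,\mathcal{B})$, with $\mathrm{dist}(y,\mathcal{B})=\inf_{z\in\mathcal{B}}\|y-z\|$. Standing assumption: the solution sets $\mathcal{S}$ and $\hat{\mathcal{S}}^N$ (for every $N$ and every sample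 realization) are nonempty. *)

theory Defs
  imports "HOL-Probability.Probability"
begin

definition cvar :: "real \<Rightarrow> 'u measure \<Rightarrow> ('u \<Rightarrow> real) \<Rightarrow> real" where
  "cvar \<alpha> P h = (INF t::real. t + (1 / \<alpha>) * (\<integral>u. max 0 (h u - t) \<partial>P))"

definition empirical_cvar :: "real \<Rightarrow> nat \<Rightarrow> (nat \<Rightarrow> 'u) \<Rightarrow> ('u \<Rightarrow> real) \<Rightarrow> real" where
  "empirical_cvar \<alpha> N us h =
     (INF t::real. t + (1 / (real N * \<alpha>)) * (\<Sum>j=1..N. max 0 (h (us j) - t)))"

definition cvar_map ::
  "real \<Rightarrow> 'u measure \<Rightarrow> ('n \<Rightarrow> real^'n \<Rightarrow> 'u \<Rightarrow> real) \<Rightarrow> real^'n \<Rightarrow> real^'n::finite" where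
  "cvar_map \<alpha> P f x = (\<chi> i. cvar \<alpha> P (\<lambda>u. f i x u))"

definition empirical_cvar_map ::
  "real \<Rightarrow> nat \<Rightarrow> (nat \<Rightarrow> 'u) \<Rightarrow> ('n \<Rightarrow> real^'n \<Rightarrow> 'u \<Rightarrow> real) \<Rightarrow> real^'n \<Rightarrow> real^'n::finite" where
  "empirical_cvar_map \<alpha> N us f x = (\<chi> i. empirical_cvar \<alpha> N us (\<lambda>u. f i x u))"

definition vi_sol :: "'a::real_inner set \<Rightarrow> ('a \<Rightarrow> 'a) \<Rightarrow> 'a set" where
  "vi_sol X G = {x\<^sub>0 \<in> X. \<forall>x\<in>X. (x - x\<^sub>0) \<bullet> G x\<^sub>0 \<ge> 0}"

(* A real-valued supremum: it is the intended one when A is nonempty and bounded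
   and B is nonempty. *)
definition set_deviation :: "'a::metric_space set \<Rightarrow> 'a set \<Rightarrow> real" where
  "set_deviation A B = (SUP y\<in>A. infdist y B)"

definition f_max :: "'x set \<Rightarrow> ('n \<Rightarrow> 'x \<Rightarrow> real) \<Rightarrow> real" where
  "f_max X ft = (SUP (i, x) \<in> UNIV \<times> X. ft i x)"

definition g_range :: "'u set \<Rightarrow> ('n \<Rightarrow> 'u \<Rightarrow> real) \<Rightarrow> real" where
  "g_range U g = (SUP i. (SUP u\<in>U. g i u) - (INF u\<in>U. g i u))"

(* If f_max X ft * g_range U g = 0 the quotient is 0 by convention, and the resulting
   tail bound is then trivial. *)
definition rate ::
  "real \<Rightarrow> 'x set \<Rightarrow> 'u set \<Rightarrow> ('n::finite \<Rightarrow> 'x \<Rightarrow> real) \<Rightarrow> ('n \<Rightarrow> 'u \<Rightarrow> real) \<Rightarrow> real \<Rightarrow> real" where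
  "rate \<alpha> X U ft g \<eta> =
     (\<alpha> * \<eta>\<^sup>2) / (11 * real CARD('n) * (f_max X ft * g_range U g)\<^sup>2)"

end

theory Submission
  imports Defs
begin

text \<open>CVaR commutes with affine maps of nonnegative slope, so after rescaling each \<open>g i\<close> to \<open>h i\<close> with
  values in \<open>[0, 1]\<close> the deviation of the two maps at every \<open>x\<close> is controlled by the \<open>n\<close> numbers
  \<open>\<bar>empirical_cvar \<alpha> N us (h i) - cvar \<alpha> P (h i)\<bar>\<close>, which do not depend on \<open>x\<close>. An optimal level
  \<open>t\<close> in the definition of the CVaR bounds the empirical value from above, and an optimal dual density
  \<open>q / \<alpha>\<close> bounds it from below. The sample means that arise have summands bounded by \<open>q\<close>, hence second
  moment at most \<open>\<alpha>\<close>, and a Bernstein-type estimate gives tails \<open>exp (- \<alpha> * \<eta>\<^sup>2 * N / 4)\<close>, better than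
  needed. The event is measurable because the empirical solution set depends on the sample only
  through the vector of these empirical CVaRs.\<close>

section \<open>CVaR over a probability space: bounds, affine maps, quantiles and duality\<close>

context prob_space
begin

text \<open>Holds because \<open>h - t\<close> lies below its positive part and
  \<open>1 / \<alpha>\<close> is at least 1. Being uniform in \<open>t\<close>, the bound makes the
  real-valued infimum in \<open>cvar\<close> one over a set bounded below, so that it behaves as
  intended.\<close>

lemma expectation_le_cvar_objective:
  fixes h :: "'a \<Rightarrow> real"
  assumes "integrable M h" "0 < \<alpha>" "\<alpha> \<le> 1"
  shows "expectation h \<le> t + (1 / \<alpha>) * expectation (\<lambda>u. max 0 (h u - t))"
proof -
  have int: "integrable M (\<lambda>u. max 0 (h u - t))"
    using assms by auto
  have "expectation h - t = expectation (\<lambda>u. h u - t)"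
    using assms by (simp add: prob_space)
  also have "\<dots> \<le> expectation (\<lambda>u. max 0 (h u - t))"
    using assms int by (intro integral_mono) auto
  also have "\<dots> \<le> (1 / \<alpha>) * expectation (\<lambda>u. max 0 (h u - t))"
    using assms mult_right_mono[of 1 "1/\<alpha>" "expectation (\<lambda>u. max 0 (h u - t))"]
    by (simp add: integral_nonneg_AE)
  finally show ?thesis by simp
qed

lemma bdd_below_cvar_objective:
  fixes h :: "'a \<Rightarrow> real"
  assumes "integrable M h" "0 < \<alpha>" "\<alpha> \<le> 1"
  shows "bdd_below (range (\<lambda>t. t + (1 / \<alpha>) * expectation (\<lambda>u. max 0 (h u - t))))"
  using expectation_le_cvar_objective[OF assms] by (rule bdd_belowI2)

lemma cvar_le_objective:
  assumes "integrable M h" "0 < \<alpha>" "\<alpha> \<le> 1"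
  shows "cvar \<alpha> M h \<le> t + (1 / \<alpha>) * expectation (\<lambda>u. max 0 (h u - t))"
  unfolding cvar_def using bdd_below_cvar_objective[OF assms] by (rule cINF_lower) simp

lemma expectation_le_cvar:
  assumes "integrable M h" "0 < \<alpha>" "\<alpha> \<le> 1"
  shows "expectation h \<le> cvar \<alpha> M h"
  unfolding cvar_def using expectation_le_cvar_objective[OF assms] by (intro cINF_greatest) auto

lemma cvar_le_upper_bound:
  assumes "integrable M h" "0 < \<alpha>" "\<alpha> \<le> 1" "AE u in M. h u \<le> b"
  shows "cvar \<alpha> M h \<le> b"
proof -
  \<comment> \<open>At the level \<open>b\<close> the positive part vanishes almost everywhere, so
    the objective there equals \<open>b\<close>.\<close>
  have "expectation (\<lambda>u. max 0 (h u - b)) = expectation (\<lambda>u. 0)"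
    using borel_measurable_integrable[OF assms(1)]
    by (intro integral_cong_AE eventually_mono[OF assms(4)]) auto
  with cvar_le_objective[OF assms(1-3), of b] show ?thesis by simp
qed

text \<open>Substituting the level \<open>k * t + d\<close> turns the objective of the affine image
  into \<open>k\<close> times the objective of \<open>h\<close> at \<open>t\<close>, plus
  \<open>d\<close>.\<close>

lemma cvar_affine_le:
  fixes h :: "'a \<Rightarrow> real"
  assumes h: "integrable M h" and \<alpha>: "0 < \<alpha>" "\<alpha> \<le> 1" and k: "0 < k"
  shows "cvar \<alpha> M (\<lambda>u. k * h u + d) \<le> k * cvar \<alpha> M h + d"
proof -
  have "(cvar \<alpha> M (\<lambda>u. k * h u + d) - d) / k \<le> cvar \<alpha> M h"
    unfolding cvar_def[of \<alpha> M h]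
  proof (rule cINF_greatest)
    fix t :: real
    have "cvar \<alpha> M (\<lambda>u. k * h u + d)
        \<le> (k * t + d) + (1 / \<alpha>) * expectation (\<lambda>u. max 0 (k * h u + d - (k * t + d)))"
      using h \<alpha> by (intro cvar_le_objective) auto
    also have "(\<lambda>u. max 0 (k * h u + d - (k * t + d))) = (\<lambda>u. k * max 0 (h u - t))"
      using k by (auto simp: max_def algebra_simps)
    finally show "(cvar \<alpha> M (\<lambda>u. k * h u + d) - d) / k
        \<le> t + (1 / \<alpha>) * expectation (\<lambda>u. max 0 (h u - t))"
      using k by (simp add: field_simps)
  qed simp
  with k show ?thesis by (simp add: field_simps)
qed

text \<open>The reverse inequality is \<open>cvar_affine_le\<close> applied to the inverse affine
  map. For slope 0 the function is constant and its CVaR is squeezed between its mean and its upper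
  bound.\<close>

lemma cvar_affine:
  fixes h :: "'a \<Rightarrow> real"
  assumes h: "integrable M h" and \<alpha>: "0 < \<alpha>" "\<alpha> \<le> 1" and k: "0 \<le> k"
  shows "cvar \<alpha> M (\<lambda>u. k * h u + d) = k * cvar \<alpha> M h + d"
proof (cases "k = 0")
  case True
  then show ?thesis
    using expectation_le_cvar[of "\<lambda>u. d" \<alpha>] cvar_le_upper_bound[of "\<lambda>u. d" \<alpha> d] \<alpha>
    by (simp add: prob_space)
next
  case False
  then have k: "k > 0" using k by simp
  have "cvar \<alpha> M (\<lambda>u. (1/k) * (k * h u + d) + (- d / k)) \<le> (1/k) * cvar \<alpha> M (\<lambda>u. k * h u + d) + (- d / k)"
    using h \<alpha> k by (intro cvar_affine_le) auto
  also have "(\<lambda>u. (1/k) * (k * h u + d) + (- d / k)) = h"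
    using k by (auto simp: field_simps)
  finally have "k * cvar \<alpha> M h + d \<le> cvar \<alpha> M (\<lambda>u. k * h u + d)"
    using k by (simp add: field_simps)
  with cvar_affine_le[OF h \<alpha> k, of d] show ?thesis by simp
qed

text \<open>Take \<open>t\<close> as the infimum of the levels whose strict upper tail has mass at
  most \<alpha>. All levels above \<open>t\<close> have this property, and continuity from below
  carries it to \<open>t\<close>; levels below \<open>t\<close> have tail mass above \<alpha>, and
  continuity from above gives the non-strict bound.\<close>

lemma ex_upper_quantile:
  fixes h :: "'a \<Rightarrow> real"
  assumes h[measurable]: "h \<in> borel_measurable M"
    and h01: "\<And>u. u \<in> space M \<Longrightarrow> 0 \<le> h u \<and> h u \<le> 1" and \<alpha>: "0 < \<alpha>" "\<alpha> < 1"
  obtains t where "0 \<le> t" "t \<le> 1" "prob {u\<in>space M. t < h u} \<le> \<alpha>" "\<alpha> \<le> prob {u\<in>space M. t \<le> h u}"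
proof -
  define T where "T = {t. prob {u\<in>space M. t < h u} \<le> \<alpha>}"
  define t where "t = Inf T"
  have "{u\<in>space M. 1 < h u} = {}" using h01 by fastforce
  then have "prob {u\<in>space M. 1 < h u} = 0" by (simp only: measure_empty)
  then have 1: "1 \<in> T" unfolding T_def using \<alpha> by simp
  have nonneg: "0 \<le> s" if "s \<in> T" for s
  proof (rule ccontr)
    assume "\<not> 0 \<le> s"
    then have "{u\<in>space M. s < h u} = space M" using h01 by force
    with that \<alpha> show False by (simp add: T_def prob_space)
  qed
  then have bdd: "bdd_below T" by (rule bdd_belowI)
  have below: "s \<notin> T" if "s < t" for s
    using cInf_lower[OF _ bdd, of s] that by (force simp: t_def)
  have above: "s \<in> T" if "t < s" for s
  proof -
    have "T \<noteq> {}" using 1 by blast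
    then obtain r where r: "r \<in> T" "r < s"
      using cInf_lessD[of T s] \<open>t < s\<close> unfolding t_def by blast
    then have "prob {u\<in>space M. s < h u} \<le> prob {u\<in>space M. r < h u}"
      by (intro finite_measure_mono) auto
    with r show ?thesis by (simp add: T_def)
  qed
  have "(\<lambda>n. prob {u\<in>space M. t + 1 / real (Suc n) < h u}) \<longlonglongrightarrow> prob (\<Union>n. {u\<in>space M. t + 1 / real (Suc n) < h u})"
  proof (rule finite_Lim_measure_incseq)
    show "incseq (\<lambda>n. {u\<in>space M. t + 1 / real (Suc n) < h u})"
    proof (rule incseq_SucI)
      fix n
      have "1 / real (Suc (Suc n)) \<le> 1 / real (Suc n)" by (simp add: field_simps)
      then show "{u\<in>space M. t + 1 / real (Suc n) < h u} \<subseteq> {u\<in>space M. t + 1 / real (Suc (Suc n)) < h u}"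
        by force
    qed
  qed auto
  also have "(\<Union>n. {u\<in>space M. t + 1 / real (Suc n) < h u}) = {u\<in>space M. t < h u}"
  proof safe
    fix u n assume "t + 1 / real (Suc n) < h u"
    moreover have "0 < 1 / real (Suc n)" by simp
    ultimately show "t < h u" by linarith
  next
    fix u assume "u \<in> space M" "t < h u"
    then obtain n where "1 / real (Suc n) < h u - t"
      using nat_approx_posE[of "h u - t"] by auto
    then have "t + 1 / real (Suc n) < h u" by linarith
    with \<open>u \<in> space M\<close> show "u \<in> (\<Union>n. {u\<in>space M. t + 1 / real (Suc n) < h u})" by blast
  qed
  finally have upper: "prob {u\<in>space M. t < h u} \<le> \<alpha>"
    by (rule LIMSEQ_le_const2) (use above in \<open>auto simp: T_def\<close>)
  have "(\<lambda>n. prob {u\<in>space M. t - 1 / real (Suc n) < h u}) \<longlonglongrightarrow> prob (\<Inter>n. {u\<in>space M. t - 1 / real (Suc n) < h u})"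
  proof (rule finite_Lim_measure_decseq)
    show "decseq (\<lambda>n. {u\<in>space M. t - 1 / real (Suc n) < h u})"
    proof (rule decseq_SucI)
      fix n
      have "1 / real (Suc (Suc n)) \<le> 1 / real (Suc n)" by (simp add: field_simps)
      then show "{u\<in>space M. t - 1 / real (Suc (Suc n)) < h u} \<subseteq> {u\<in>space M. t - 1 / real (Suc n) < h u}"
        by force
    qed
  qed auto
  also have "(\<Inter>n. {u\<in>space M. t - 1 / real (Suc n) < h u}) = {u\<in>space M. t \<le> h u}"
  proof safe
    fix u assume *: "u \<in> (\<Inter>n. {u\<in>space M. t - 1 / real (Suc n) < h u})"
    then show "u \<in> space M" by auto
    show "t \<le> h u"
    proof (rule ccontr)
      assume "\<not> t \<le> h u"
      then obtain n where "1 / real (Suc n) < t - h u"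
        using nat_approx_posE[of "t - h u"] by auto
      moreover have "t - 1 / real (Suc n) < h u" using * by auto
      ultimately show False by linarith
    qed
  next
    fix u n assume "t \<le> h u"
    moreover have "0 < 1 / real (Suc n)" by simp
    ultimately show "t - 1 / real (Suc n) < h u" by linarith
  qed
  finally have lower: "\<alpha> \<le> prob {u\<in>space M. t \<le> h u}"
  proof (rule LIMSEQ_le_const)
    have "\<alpha> \<le> prob {u\<in>space M. t - 1 / real (Suc n) < h u}" for n
      using below[of "t - 1 / real (Suc n)"] by (simp add: T_def)
    then show "\<exists>N. \<forall>n\<ge>N. \<alpha> \<le> prob {u\<in>space M. t - 1 / real (Suc n) < h u}" by blast
  qed
  have "0 \<le> t" "t \<le> 1"
    using cInf_greatest[of T 0] nonneg 1 cInf_lower[OF 1 bdd] by (auto simp: t_def)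
  then show ?thesis using upper lower by (rule that)
qed

text \<open>\<open>q / \<alpha>\<close> is the extremal density in the dual representation of the CVaR; splitting the atom
  of \<open>h\<close> at the quantile \<open>t\<close> makes it integrate to one.\<close>

lemma cvar_dual:
  fixes h :: "'a \<Rightarrow> real"
  assumes h[measurable]: "h \<in> borel_measurable M"
    and h01: "\<And>u. u \<in> space M \<Longrightarrow> 0 \<le> h u \<and> h u \<le> 1" and \<alpha>: "0 < \<alpha>" "\<alpha> < 1"
  obtains q t where "q \<in> borel_measurable M" "\<And>u. 0 \<le> q u \<and> q u \<le> 1" "expectation q = \<alpha>"
    "0 \<le> t" "t \<le> 1" "\<And>u. max 0 (h u - t) = q u * (h u - t)"
    "\<alpha> * cvar \<alpha> M h = expectation (\<lambda>u. q u * h u)"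
proof -
  obtain t where t: "0 \<le> t" "t \<le> 1" "prob {u\<in>space M. t < h u} \<le> \<alpha>" "\<alpha> \<le> prob {u\<in>space M. t \<le> h u}"
    using ex_upper_quantile[OF assms] .
  define p e where "p = prob {u\<in>space M. t < h u}" and "e = prob {u\<in>space M. h u = t}"
  have "{u\<in>space M. t \<le> h u} = {u\<in>space M. t < h u} \<union> {u\<in>space M. h u = t}" by auto
  then have pe: "prob {u\<in>space M. t \<le> h u} = p + e"
    unfolding p_def e_def by (simp only:, intro finite_measure_Union) auto
  \<comment> \<open>The fraction of the atom at \<open>t\<close> that brings the mass up to
    \<alpha>. If the atom is null, the two quantile bounds force \<open>p = \<alpha>\<close>, so the
    value 0 is harmless.\<close>
  define l where "l = (if e = 0 then 0 else (\<alpha> - p) / e)"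
  have "0 \<le> e" by (simp add: e_def)
  then have l: "0 \<le> l" "l \<le> 1" "p + l * e = \<alpha>"
    using t pe by (auto simp: l_def p_def field_simps)
  define q where "q = (\<lambda>u. if t < h u then 1 else if h u = t then l else 0)"
  have q01: "0 \<le> q u \<and> q u \<le> 1" for u using l by (simp add: q_def)
  have q[measurable]: "q \<in> borel_measurable M" unfolding q_def by measurable
  have bounded_int: "integrable M v" if "v \<in> borel_measurable M" "\<And>u. u \<in> space M \<Longrightarrow> \<bar>v u\<bar> \<le> 1" for v :: "'a \<Rightarrow> real"
    using that by (intro integrable_const_bound[of _ 1]) auto
  have inth: "integrable M h" using h01 by (intro bounded_int) fastforce+
  have intq: "integrable M q" using q01 by (intro bounded_int) auto
  have intqh: "integrable M (\<lambda>u. q u * h u)"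
    using q01 h01 by (intro bounded_int) (auto intro!: mult_le_one simp: abs_mult)
  have "expectation q = expectation (\<lambda>u. indicat_real {u\<in>space M. t < h u} u + l * indicat_real {u\<in>space M. h u = t} u)"
    by (intro Bochner_Integration.integral_cong) (auto simp: q_def)
  also have "\<dots> = p + l * e"
    by (subst Bochner_Integration.integral_add)
       (auto simp: p_def e_def less_top[symmetric] intro!: arg_cong2[where f = "(+)"] arg_cong2[where f = "(*)"] arg_cong[where f = "measure M"])
  finally have Eq: "expectation q = \<alpha>" using l by simp
  have Zq: "max 0 (h u - t) = q u * (h u - t)" for u by (simp add: q_def max_def)
  \<comment> \<open>As \<open>q\<close> has mean \<alpha>, the level \<open>s\<close> cancels. Since
    \<open>q * (h - s)\<close> lies below the positive part for every \<open>s\<close>, with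
    equality at the quantile \<open>t\<close>, this constant is a lower bound of the objective and
    is attained.\<close>
  have objq: "s + (1 / \<alpha>) * expectation (\<lambda>u. q u * (h u - s)) = expectation (\<lambda>u. q u * h u) / \<alpha>" for s
  proof -
    have "expectation (\<lambda>u. q u * (h u - s)) = expectation (\<lambda>u. q u * h u - s * q u)"
      by (intro Bochner_Integration.integral_cong) (auto simp: algebra_simps)
    also have "\<dots> = expectation (\<lambda>u. q u * h u) - s * \<alpha>"
      using intq intqh Eq by simp
    finally show ?thesis using \<alpha> by (simp add: field_simps)
  qed
  have "expectation (\<lambda>u. q u * h u) / \<alpha> \<le> cvar \<alpha> M h"
    unfolding cvar_def
  proof (rule cINF_greatest)
    fix s :: real
    have "expectation (\<lambda>u. q u * (h u - s)) \<le> expectation (\<lambda>u. max 0 (h u - s))"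
    proof (rule integral_mono)
      show "integrable M (\<lambda>u. q u * (h u - s))"
        using intq intqh by (simp add: right_diff_distrib)
      show "integrable M (\<lambda>u. max 0 (h u - s))" using inth by simp
      show "q u * (h u - s) \<le> max 0 (h u - s)" for u
        using q01[of u] by (cases "s \<le> h u") (auto simp: max_def mult_left_le_one_le mult_nonneg_nonpos)
    qed
    then have "s + (1 / \<alpha>) * expectation (\<lambda>u. q u * (h u - s)) \<le> s + (1 / \<alpha>) * expectation (\<lambda>u. max 0 (h u - s))"
      using \<alpha> by (simp add: divide_right_mono)
    then show "expectation (\<lambda>u. q u * h u) / \<alpha> \<le> s + (1 / \<alpha>) * expectation (\<lambda>u. max 0 (h u - s))"
      unfolding objq .
  qed simp
  moreover have "cvar \<alpha> M h \<le> expectation (\<lambda>u. q u * h u) / \<alpha>"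
    using cvar_le_objective[OF inth, of \<alpha> t] \<alpha> unfolding Zq objq by simp
  ultimately have "\<alpha> * cvar \<alpha> M h = expectation (\<lambda>u. q u * h u)"
    using \<alpha> by (simp add: field_simps)
  with q q01 Eq t Zq show ?thesis by (intro that[of q t]) auto
qed

end

section \<open>Empirical CVaR as the CVaR of a uniform law\<close>

text \<open>Viewing the sample as a random variable on uniformly distributed indices lets every
  result on \<open>cvar\<close> apply to samples, without a second proof for finite sums.\<close>

lemma empirical_cvar_eq_cvar:
  assumes "N \<ge> 1"
  shows "empirical_cvar \<alpha> N us h = cvar \<alpha> (measure_pmf (pmf_of_set {1..N})) (\<lambda>j. h (us j))"
  using assms by (simp add: empirical_cvar_def cvar_def integral_pmf_of_set mult.commute)

lemma integrable_pmf_of_set: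
  fixes v :: "nat \<Rightarrow> real"
  assumes "N \<ge> 1"
  shows "integrable (measure_pmf (pmf_of_set {1..N})) v"
  using assms by (intro integrable_measure_pmf_finite) simp

lemma empirical_cvar_affine:
  assumes "N \<ge> 1" "0 < \<alpha>" "\<alpha> \<le> 1" "0 \<le> k"
  shows "empirical_cvar \<alpha> N us (\<lambda>u. k * h u + d) = k * empirical_cvar \<alpha> N us h + d"
  unfolding empirical_cvar_eq_cvar[OF assms(1)]
  using assms by (intro measure_pmf.cvar_affine integrable_pmf_of_set)

text \<open>The objective is continuous in the level, so the infimum over all reals equals the one
  over the rationals, and a countable infimum of measurable functions is measurable.\<close>

lemma borel_measurable_empirical_cvar:
  fixes h :: "'u \<Rightarrow> real"
  assumes [measurable]: "h \<in> borel_measurable P" and "N \<ge> 1" "0 < \<alpha>" "\<alpha> \<le> 1"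
  shows "(\<lambda>us. empirical_cvar \<alpha> N us h) \<in> borel_measurable (PiM {1..N} (\<lambda>_. P))"
proof -
  define G where "G us t = t + (1 / (real N * \<alpha>)) * (\<Sum>j=1..N. max 0 (h (us j) - t))" for us t
  have bdd: "bdd_below (range (G us))" for us
    using prob_space.bdd_below_cvar_objective[OF measure_pmf.prob_space_axioms
        integrable_pmf_of_set[OF assms(2), of "\<lambda>j. h (us j)"] assms(3,4)] assms(2)
    by (simp add: G_def integral_pmf_of_set mult.commute)
  have "(INF t. G us t) = (INF t\<in>\<rat>. G us t)" for us
  proof (rule antisym)
    show "(INF t. G us t) \<le> (INF t\<in>\<rat>. G us t)"
      using bdd by (intro cINF_superset_mono) (auto intro: bdd_below_mono[OF bdd])
    show "(INF t\<in>\<rat>. G us t) \<le> (INF t. G us t)"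
    proof (rule cINF_greatest)
      fix t :: real
      show "(INF t\<in>\<rat>. G us t) \<le> G us t"
      proof (rule continuous_ge_on_closure[where S = \<rat> and f = "G us" and x = t])
        show "continuous_on (closure \<rat>) (G us)" unfolding G_def by (intro continuous_intros)
        show "(INF t\<in>\<rat>. G us t) \<le> G us s" if "s \<in> \<rat>" for s
          using that by (intro cINF_lower bdd_below_mono[OF bdd[of us]]) auto
      qed (simp add: Rats_closure_real)
    qed simp
  qed
  then have "(\<lambda>us. empirical_cvar \<alpha> N us h) = (\<lambda>us. INF t\<in>\<rat>. G us t)"
    by (simp add: empirical_cvar_def G_def)
  also have "\<dots> \<in> borel_measurable (PiM {1..N} (\<lambda>_. P))"
    unfolding G_def by (intro borel_measurable_cINF_real) (auto simp: countable_rat)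
  finally show ?thesis .
qed

section \<open>Exponential tail bounds for sample sums and for the empirical CVaR\<close>

text \<open>For negative \<open>x = - y\<close> the claim amounts to
  \<open>1 \<le> (1 - y + y^2) * exp y\<close>, which follows from the quadratic Taylor lower bound
  of \<open>exp y\<close>.\<close>

lemma exp_le_one_plus_quadratic:
  fixes x :: real
  assumes "\<bar>x\<bar> \<le> 1"
  shows "exp x \<le> 1 + x + x\<^sup>2"
proof (cases "0 \<le> x")
  case True
  then show ?thesis using exp_bound[of x] assms by simp
next
  case False
  define y where "y = - x"
  have y: "0 \<le> y" using False by (simp add: y_def)
  have "1 \<le> (1 - y + y\<^sup>2) * (1 + y + y\<^sup>2 / 2)"
  proof -
    have "(1 - y + y\<^sup>2) * (1 + y + y\<^sup>2 / 2) = 1 + y\<^sup>2 / 2 + y^3 / 2 + y^4 / 2"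
      by (simp add: field_simps power2_eq_square power3_eq_cube power4_eq_xxxx)
    then show ?thesis using y by simp
  qed
  also have "\<dots> \<le> (1 - y + y\<^sup>2) * exp y"
  proof (rule mult_left_mono)
    show "1 + y + y\<^sup>2 / 2 \<le> exp y" using exp_lower_Taylor_quadratic[OF y] by simp
    show "0 \<le> 1 - y + y\<^sup>2" using assms by (simp add: y_def)
  qed
  finally show ?thesis by (simp add: y_def exp_minus field_simps)
qed

context prob_space
begin

text \<open>As \<open>Z\<close> is bounded by 1, its square is at most its absolute value, so the
  second moment is at most \<alpha>. This is what makes the final exponent linear in
  \<alpha>.\<close>

lemma mgf_le:
  fixes Z :: "'a \<Rightarrow> real"
  assumes [measurable]: "Z \<in> borel_measurable M" and Z1: "\<And>u. u \<in> space M \<Longrightarrow> \<bar>Z u\<bar> \<le> 1"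
    and \<alpha>: "expectation (\<lambda>u. \<bar>Z u\<bar>) \<le> \<alpha>" and s: "0 \<le> s" "s \<le> 1"
  shows "integrable M (\<lambda>u. exp (s * Z u))"
    and "expectation (\<lambda>u. exp (s * Z u)) \<le> exp (s * expectation Z + s\<^sup>2 * \<alpha>)"
proof -
  have intZ: "integrable M Z" using Z1 by (intro integrable_const_bound[of _ 1]) auto
  have sZ: "\<bar>s * Z u\<bar> \<le> 1" if "u \<in> space M" for u
    using Z1[OF that] s by (simp add: abs_mult mult_le_one)
  show int: "integrable M (\<lambda>u. exp (s * Z u))"
    using sZ by (intro integrable_const_bound[of _ "exp 1"]) force+
  have "expectation (\<lambda>u. exp (s * Z u)) \<le> expectation (\<lambda>u. 1 + s * Z u + s\<^sup>2 * \<bar>Z u\<bar>)"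
  proof (rule integral_mono[OF int])
    fix u assume u: "u \<in> space M"
    have "exp (s * Z u) \<le> 1 + s * Z u + s\<^sup>2 * \<bar>Z u\<bar>\<^sup>2"
      using exp_le_one_plus_quadratic[OF sZ[OF u]] by (simp add: power_mult_distrib)
    also have "\<dots> \<le> 1 + s * Z u + s\<^sup>2 * \<bar>Z u\<bar>"
      using Z1[OF u] mult_left_le[of "\<bar>Z u\<bar>" "\<bar>Z u\<bar>"]
      by (intro add_left_mono mult_left_mono) (simp_all add: power2_eq_square del: abs_mult_self_eq)
    finally show "exp (s * Z u) \<le> 1 + s * Z u + s\<^sup>2 * \<bar>Z u\<bar>" .
  qed (use intZ in auto)
  also have "\<dots> = 1 + s * expectation Z + s\<^sup>2 * expectation (\<lambda>u. \<bar>Z u\<bar>)"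
    using intZ by (simp add: prob_space)
  also have "\<dots> \<le> 1 + (s * expectation Z + s\<^sup>2 * \<alpha>)"
    using \<alpha> by (simp add: mult_left_mono)
  also have "\<dots> \<le> exp (s * expectation Z + s\<^sup>2 * \<alpha>)" by (rule exp_ge_add_one_self)
  finally show "expectation (\<lambda>u. exp (s * Z u)) \<le> exp (s * expectation Z + s\<^sup>2 * \<alpha>)" .
qed

text \<open>Chernoff's method: Markov's inequality for the product of the exponentials, whose
  integral factors over the product measure.\<close>

lemma sample_sum_upper_tail:
  fixes Z :: "'a \<Rightarrow> real"
  assumes Z[measurable]: "Z \<in> borel_measurable M" and Z1: "\<And>u. u \<in> space M \<Longrightarrow> \<bar>Z u\<bar> \<le> 1"
    and \<alpha>: "expectation (\<lambda>u. \<bar>Z u\<bar>) \<le> \<alpha>" and \<eta>: "0 \<le> \<eta>" "\<eta> \<le> 2"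
  shows "measure (PiM {1..N} (\<lambda>_. M))
      {us \<in> space (PiM {1..N} (\<lambda>_. M)). real N * (expectation Z + \<alpha> * \<eta>) \<le> (\<Sum>j=1..N. Z (us j))}
    \<le> exp (- (\<alpha> * \<eta>\<^sup>2 / 4 * real N))"
proof -
  interpret Pi: product_prob_space "\<lambda>_::nat. M" "{1..N}" by unfold_locales
  let ?P = "PiM {1..N} (\<lambda>_::nat. M)"
  \<comment> \<open>Minimises \<open>s^2 * \<alpha> - s * \<alpha> * \<eta>\<close>, with minimum
    \<open>- \<alpha> * \<eta>^2 / 4\<close>; the bound \<open>\<eta> \<le> 2\<close> ensures
    \<open>s \<le> 1\<close>.\<close>
  define s where "s = \<eta> / 2"
  have s: "0 \<le> s" "s \<le> 1" using \<eta> by (auto simp: s_def)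
  define c where "c = exp (s * (real N * (expectation Z + \<alpha> * \<eta>)))"
  define v where "v us = (\<Prod>j\<in>{1..N}. exp (s * Z (us j)))" for us
  note mgf = mgf_le[OF Z Z1 \<alpha> s]
  have int: "integrable ?P v"
    unfolding v_def by (intro Pi.product_integrable_prod mgf) auto
  have "(\<integral>us. v us \<partial>?P) = (\<Prod>j\<in>{1..N}. expectation (\<lambda>u. exp (s * Z u)))"
    unfolding v_def by (intro Pi.product_integral_prod mgf) auto
  also have "\<dots> \<le> exp (s * expectation Z + s\<^sup>2 * \<alpha>) ^ N"
    using mgf(2) by (simp add: power_mono integral_nonneg_AE)
  finally have Ev: "(\<integral>us. v us \<partial>?P) \<le> exp (real N * (s * expectation Z + s\<^sup>2 * \<alpha>))"
    by (simp add: exp_of_nat_mult)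
  have "measure ?P {us \<in> space ?P. real N * (expectation Z + \<alpha> * \<eta>) \<le> (\<Sum>j=1..N. Z (us j))}
      \<le> measure ?P {us \<in> space ?P. c \<le> v us}"
  proof (rule Pi.finite_measure_mono)
    show "{us \<in> space ?P. real N * (expectation Z + \<alpha> * \<eta>) \<le> (\<Sum>j=1..N. Z (us j))} \<subseteq> {us \<in> space ?P. c \<le> v us}"
      using s by (auto simp: c_def v_def exp_sum[symmetric] sum_distrib_left[symmetric] intro: mult_left_mono)
    show "{us \<in> space ?P. c \<le> v us} \<in> sets ?P"
      using int by measurable
  qed
  also have "\<dots> \<le> (\<integral>us. v us \<partial>?P) / c"
    by (intro integral_Markov_inequality_measure[OF int, of "{}"]) (auto simp: v_def c_def intro!: prod_nonneg)
  also have "\<dots> \<le> exp (real N * (s * expectation Z + s\<^sup>2 * \<alpha>)) / c"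
    using Ev by (simp add: c_def divide_right_mono)
  also have "\<dots> = exp (- (\<alpha> * \<eta>\<^sup>2 / 4 * real N))"
    by (simp add: c_def s_def exp_diff[symmetric] field_simps power2_eq_square)
  finally show ?thesis .
qed

text \<open>The weights \<open>q / \<alpha>\<close> need not integrate to one, hence the two alternatives.\<close>

lemma cvar_ge_weighted:
  fixes h q :: "'a \<Rightarrow> real"
  assumes int: "integrable M h" "integrable M q" "integrable M (\<lambda>u. q u * h u)"
    and h01: "AE u in M. 0 \<le> h u \<and> h u \<le> 1"
    and q01: "\<And>u. 0 \<le> q u \<and> q u \<le> 1" and \<alpha>: "0 < \<alpha>" "\<alpha> \<le> 1"
  shows "min (expectation (\<lambda>u. q u * h u) / \<alpha>) (1 - expectation (\<lambda>u. q u * (1 - h u)) / \<alpha>) \<le> cvar \<alpha> M h"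
  unfolding cvar_def
proof (rule cINF_greatest)
  fix t :: real
  define E where "E = expectation (\<lambda>u. max 0 (h u - t))"
  define A where "A = expectation (\<lambda>u. q u * h u)"
  define W where "W = expectation q"
  have B: "expectation (\<lambda>u. q u * (1 - h u)) = W - A"
    using int by (simp add: A_def W_def right_diff_distrib)
  have A0: "0 \<le> A"
    unfolding A_def by (intro integral_nonneg_AE eventually_mono[OF h01]) (use q01 in auto)
  have AW: "0 \<le> W - A"
    unfolding B[symmetric] by (intro integral_nonneg_AE eventually_mono[OF h01]) (use q01 in auto)
  have E0: "0 \<le> E" unfolding E_def by simp
  have intE: "integrable M (\<lambda>u. max 0 (h u - t))" using int by simp
  have dual: "A - t * W \<le> E"
  proof -
    have "A - t * W = expectation (\<lambda>u. q u * h u - t * q u)"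
      using int by (simp add: A_def W_def)
    also have "\<dots> \<le> E"
      unfolding E_def
    proof (rule integral_mono[OF _ intE])
      show "q u * h u - t * q u \<le> max 0 (h u - t)" for u
      proof -
        have "q u * (h u - t) \<le> max 0 (h u - t)"
          using q01[of u] by (cases "t \<le> h u") (auto simp: max_def mult_left_le_one_le mult_nonneg_nonpos)
        then show ?thesis by (simp add: algebra_simps)
      qed
    qed (use int in auto)
    finally show ?thesis .
  qed
  have Ah: "A \<le> expectation h"
    unfolding A_def
    by (intro integral_mono_AE eventually_mono[OF h01]) (use int q01 in \<open>auto simp: mult_left_le_one_le\<close>)
  have obj: "t + (1 / \<alpha>) * E = (\<alpha> * t + E) / \<alpha>" using \<alpha> by (simp add: field_simps)
  \<comment> \<open>Below 0 the objective is compared with the mean of \<open>h\<close>, above 1 the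
    linear term suffices. In between \<open>dual\<close> applies: if \<open>W \<le> \<alpha>\<close>
    then \<open>t * W\<close> is at most \<open>\<alpha> * t\<close>, and otherwise the excess
    \<open>t * (W - \<alpha>)\<close> is at most \<open>W - \<alpha>\<close>.\<close>
  consider "t < 0" | "1 < t" | "0 \<le> t" "t \<le> 1" "W \<le> \<alpha>" | "0 \<le> t" "t \<le> 1" "\<alpha> < W" by linarith
  then have "A \<le> \<alpha> * t + E \<or> \<alpha> - (W - A) \<le> \<alpha> * t + E"
  proof cases
    case 1
    have "expectation h - t = expectation (\<lambda>u. h u - t)"
      using int by (simp add: prob_space)
    also have "\<dots> \<le> E" unfolding E_def using int intE by (intro integral_mono) auto
    finally have "expectation h - t \<le> E" .
    moreover have "t \<le> \<alpha> * t" using 1 \<alpha> mult_right_mono_neg[of \<alpha> 1 t] by simp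
    ultimately show ?thesis using Ah by simp
  next
    case 2
    then have "\<alpha> \<le> \<alpha> * t" using \<alpha> by simp
    then show ?thesis using E0 AW by simp
  next
    case 3
    then have "t * W \<le> \<alpha> * t" by (simp add: mult.commute[of t] mult_right_mono)
    then show ?thesis using dual by simp
  next
    case 4
    then have "t * (W - \<alpha>) \<le> W - \<alpha>" by (simp add: mult_left_le_one_le)
    then show ?thesis using dual by (simp add: algebra_simps)
  qed
  then have "A / \<alpha> \<le> t + (1 / \<alpha>) * E \<or> 1 - (W - A) / \<alpha> \<le> t + (1 / \<alpha>) * E"
    using \<alpha> divide_right_mono[of A "\<alpha> * t + E" \<alpha>] divide_right_mono[of "\<alpha> - (W - A)" "\<alpha> * t + E" \<alpha>]
    unfolding obj by (auto simp: diff_divide_distrib)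
  then show "min (expectation (\<lambda>u. q u * h u) / \<alpha>) (1 - expectation (\<lambda>u. q u * (1 - h u)) / \<alpha>)
      \<le> t + (1 / \<alpha>) * expectation (\<lambda>u. max 0 (h u - t))"
    unfolding B A_def[symmetric] E_def[symmetric] by linarith
qed simp

text \<open>The deviation event is covered by three one-sided events about sample means, one for
  overestimation and two for underestimation; the union bound gives the factor 3.\<close>

lemma empirical_cvar_tail:
  fixes h :: "'a \<Rightarrow> real"
  assumes h[measurable]: "h \<in> borel_measurable M"
    and h01: "\<And>u. u \<in> space M \<Longrightarrow> 0 \<le> h u \<and> h u \<le> 1" and \<alpha>: "0 < \<alpha>" "\<alpha> < 1"
    and N: "N \<ge> 1" and \<eta>: "0 \<le> \<eta>"
  shows "measure (PiM {1..N} (\<lambda>_. M))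
      {us \<in> space (PiM {1..N} (\<lambda>_. M)). \<eta> < \<bar>empirical_cvar \<alpha> N us h - cvar \<alpha> M h\<bar>}
    \<le> 3 * exp (- (\<alpha> * \<eta>\<^sup>2 / 4 * real N))"
    (is "measure ?P ?A \<le> _")
proof -
  interpret Pi: product_prob_space "\<lambda>_::nat. M" "{1..N}" by unfold_locales
  define c where "c = cvar \<alpha> M h"
  define e where "e us = empirical_cvar \<alpha> N us h" for us
  have us: "us j \<in> space M" if "us \<in> space ?P" "j \<in> {1..N}" for us j
    using that by (auto simp: space_PiM)
  have inth: "integrable M h" using h01 by (intro integrable_const_bound[of _ 1]) auto
  let ?U = "measure_pmf (pmf_of_set {1..N})"
  have meanU: "integral\<^sup>L ?U v = (\<Sum>j=1..N. v j) / real N" for v :: "nat \<Rightarrow> real"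
    using N by (simp add: integral_pmf_of_set)
  note intU = integrable_pmf_of_set[OF N]
  have U01: "AE j in ?U. 0 \<le> h (us j) \<and> h (us j) \<le> 1" if "us \<in> space ?P" for us
    using N h01 us[OF that] by (auto simp: AE_measure_pmf_iff)
  show ?thesis
  proof (cases "\<eta> \<le> 1")
    case False
    \<comment> \<open>Both CVaRs lie in the unit interval, so for \<open>\<eta> > 1\<close> the
      event is empty. The remaining case is within the range of
      \<open>sample_sum_upper_tail\<close>.\<close>
    have "0 \<le> expectation h" using h01 by simp
    then have "0 \<le> c" using expectation_le_cvar[OF inth, of \<alpha>] \<alpha> by (simp add: c_def)
    moreover have "c \<le> 1"
      unfolding c_def using inth \<alpha> h01 by (intro cvar_le_upper_bound) auto
    ultimately have c: "0 \<le> c" "c \<le> 1" .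
    have "0 \<le> e us \<and> e us \<le> 1" if "us \<in> space ?P" for us
      unfolding e_def empirical_cvar_eq_cvar[OF N]
    proof
      have "0 \<le> integral\<^sup>L ?U (\<lambda>j. h (us j))"
        using U01[OF that] by (intro integral_nonneg_AE) auto
      also have "\<dots> \<le> cvar \<alpha> ?U (\<lambda>j. h (us j))"
        using \<alpha> by (intro measure_pmf.expectation_le_cvar intU) auto
      finally show "0 \<le> cvar \<alpha> ?U (\<lambda>j. h (us j))" .
      show "cvar \<alpha> ?U (\<lambda>j. h (us j)) \<le> 1"
        using \<alpha> U01[OF that] by (intro measure_pmf.cvar_le_upper_bound intU) auto
    qed
    with c False have "?A = {}" unfolding c_def[symmetric] e_def[symmetric] by force
    then have "measure ?P ?A = 0" by (simp only: measure_empty)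
    then show ?thesis by simp
  next
    case True
    obtain q t where q[measurable]: "q \<in> borel_measurable M" and q01: "\<And>u. 0 \<le> q u \<and> q u \<le> 1"
      and Eq: "expectation q = \<alpha>" and t: "0 \<le> t" "t \<le> 1"
      and Zq: "\<And>u. max 0 (h u - t) = q u * (h u - t)"
      and c': "\<alpha> * cvar \<alpha> M h = expectation (\<lambda>u. q u * h u)"
      using cvar_dual[OF h h01 \<alpha>] by blast
    have intq: "integrable M q" using q01 by (intro integrable_const_bound[of _ 1]) auto
    have intqh: "integrable M (\<lambda>u. q u * h u)"
      using q01 h01 by (intro integrable_const_bound[of _ 1]) (auto intro!: mult_le_one simp: abs_mult)
    define B where "B Z = {us \<in> space ?P. real N * (expectation Z + \<alpha> * \<eta>) \<le> (\<Sum>j=1..N. Z (us j))}"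
      for Z :: "'a \<Rightarrow> real"
    \<comment> \<open>All three are dominated by \<open>q\<close>, so their absolute first moments
      are at most \<alpha>. A deviation \<open>\<alpha> * \<eta>\<close> of such a mean becomes
      \<eta> after division by \<alpha>.\<close>
    define Z1 Z2 Z3 where "Z1 = (\<lambda>u. q u * (h u - t))" and "Z2 = (\<lambda>u. - (q u * h u))"
      and "Z3 = (\<lambda>u. q u * (1 - h u))"
    have Z_meas[measurable]: "Z1 \<in> borel_measurable M" "Z2 \<in> borel_measurable M" "Z3 \<in> borel_measurable M"
      unfolding Z1_def Z2_def Z3_def by measurable
    have weighted: "\<bar>q u * r\<bar> \<le> q u" if "\<bar>r\<bar> \<le> 1" for u r
      using that q01[of u] by (simp add: abs_mult mult_left_le)
    have Zle: "\<bar>Z1 u\<bar> \<le> q u" "\<bar>Z2 u\<bar> \<le> q u" "\<bar>Z3 u\<bar> \<le> q u" if "u \<in> space M" for u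
      unfolding Z1_def Z2_def Z3_def abs_minus_cancel
      by (intro weighted; use h01[OF that] t in \<open>auto simp: abs_if\<close>)+
    have E1: "expectation Z1 = \<alpha> * (c - t)" and E2: "expectation Z2 = - \<alpha> * c"
      and E3: "expectation Z3 = \<alpha> * (1 - c)"
      using intq intqh Eq c' by (simp_all add: Z1_def Z2_def Z3_def c_def algebra_simps)
    have tail: "measure ?P (B Z) \<le> exp (- (\<alpha> * \<eta>\<^sup>2 / 4 * real N))"
      if [measurable]: "Z \<in> borel_measurable M" and Z: "\<And>u. u \<in> space M \<Longrightarrow> \<bar>Z u\<bar> \<le> q u" for Z
      unfolding B_def
    proof (rule sample_sum_upper_tail)
      have le1: "\<bar>Z u\<bar> \<le> 1" if "u \<in> space M" for u
        using Z[OF that] q01[of u] by simp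
      then show "\<And>u. u \<in> space M \<Longrightarrow> \<bar>Z u\<bar> \<le> 1" .
      have "integrable M Z" using le1 by (intro integrable_const_bound[of _ 1]) auto
      then have "expectation (\<lambda>u. \<bar>Z u\<bar>) \<le> expectation q"
        using intq Z by (intro integral_mono) auto
      then show "expectation (\<lambda>u. \<bar>Z u\<bar>) \<le> \<alpha>" using Eq by simp
    qed (use \<eta> True in auto)
    have Bsets: "B Z \<in> sets ?P" if [measurable]: "Z \<in> borel_measurable M" for Z
      unfolding B_def by measurable
    have "?A \<subseteq> B Z1 \<union> B Z2 \<union> B Z3"
    proof
      fix us assume "us \<in> ?A"
      then have P: "us \<in> space ?P" and "e us > c + \<eta> \<or> e us < c - \<eta>"
        by (auto simp: c_def e_def)
      then consider "e us > c + \<eta>" | "e us < c - \<eta>" by blast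
      then show "us \<in> B Z1 \<union> B Z2 \<union> B Z3"
      proof cases
        case 1
        \<comment> \<open>The level \<open>t\<close>, optimal for the true law, is merely a
          candidate for the empirical objective, hence an upper bound.\<close>
        have "e us \<le> t + (1 / \<alpha>) * integral\<^sup>L ?U (\<lambda>j. max 0 (h (us j) - t))"
          unfolding e_def empirical_cvar_eq_cvar[OF N] using \<alpha> by (intro measure_pmf.cvar_le_objective intU) auto
        also have "\<dots> = t + (1 / \<alpha>) * ((\<Sum>j=1..N. Z1 (us j)) / real N)"
          unfolding meanU Zq Z1_def ..
        finally have "c + \<eta> < t + (1 / \<alpha>) * ((\<Sum>j=1..N. Z1 (us j)) / real N)" using 1 by simp
        then have "us \<in> B Z1" using P \<alpha> N by (simp add: B_def E1 field_simps)
        then show ?thesis by simp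
      next
        case 2
        \<comment> \<open>On the sample the weights may average to more or less than \<alpha>. A
          small first alternative makes the mean of \<open>Z2\<close> large, a small second one that
          of \<open>Z3\<close>.\<close>
        have "min (integral\<^sup>L ?U (\<lambda>j. q (us j) * h (us j)) / \<alpha>) (1 - integral\<^sup>L ?U (\<lambda>j. q (us j) * (1 - h (us j))) / \<alpha>) \<le> e us"
          unfolding e_def empirical_cvar_eq_cvar[OF N]
          using \<alpha> q01 U01[OF P] by (intro measure_pmf.cvar_ge_weighted intU) auto
        then have "(\<Sum>j=1..N. q (us j) * h (us j)) / real N / \<alpha> < c - \<eta>
            \<or> 1 - (\<Sum>j=1..N. q (us j) * (1 - h (us j))) / real N / \<alpha> < c - \<eta>"
          using 2 unfolding meanU by linarith
        then show ?thesis
        proof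
          assume "(\<Sum>j=1..N. q (us j) * h (us j)) / real N / \<alpha> < c - \<eta>"
          then have "us \<in> B Z2" using P \<alpha> N
            unfolding B_def E2 by (simp add: Z2_def sum_negf field_simps)
          then show ?thesis by simp
        next
          assume "1 - (\<Sum>j=1..N. q (us j) * (1 - h (us j))) / real N / \<alpha> < c - \<eta>"
          then have "us \<in> B Z3" using P \<alpha> N
            unfolding B_def E3 by (simp add: Z3_def field_simps)
          then show ?thesis by simp
        qed
      qed
    qed
    then have "measure ?P ?A \<le> measure ?P (B Z1 \<union> B Z2 \<union> B Z3)"
      by (intro Pi.finite_measure_mono sets.Un Bsets Z_meas)
    also have "\<dots> \<le> measure ?P (B Z1) + measure ?P (B Z2) + measure ?P (B Z3)"
      using measure_Un_le[OF sets.Un[OF Bsets Bsets] Bsets, OF Z_meas] measure_Un_le[OF Bsets Bsets, OF Z_meas(1,2)]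
      by linarith
    also have "\<dots> \<le> 3 * exp (- (\<alpha> * \<eta>\<^sup>2 / 4 * real N))"
      using tail[of Z1] tail[of Z2] tail[of Z3] Zle by simp
    finally show ?thesis .
  qed
qed

end

section \<open>Measurability of the event on solution sets\<close>

text \<open>Continuity of \<open>infdist\<close> on the compact \<open>X\<close> bounds the
  distances, so the real-valued supremum is the intended one and the event can be stated
  pointwise.\<close>

lemma set_deviation_le_iff:
  assumes "A \<noteq> {}" "A \<subseteq> X" "compact X"
  shows "set_deviation A B \<le> e \<longleftrightarrow> (\<forall>y\<in>A. infdist y B \<le> e)"
proof -
  have "compact ((\<lambda>y. infdist y B) ` X)"
    using assms(3) by (intro compact_continuous_image continuous_intros)
  then have "bdd_above ((\<lambda>y. infdist y B) ` A)"
    using assms(2) by (meson bdd_above_mono bounded_imp_bdd_above compact_imp_bounded image_mono)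
  then show ?thesis
    unfolding set_deviation_def using assms(1) by (intro cSUP_le_iff)
qed

text \<open>The complement is a countable union of sets that are closed, being projections of closed sets
  along the compact \<open>X\<close>.\<close>

lemma borel_vi_sol_near:
  fixes G :: "'b::euclidean_space \<Rightarrow> 'a::euclidean_space \<Rightarrow> 'a"
  assumes X: "compact X" and G: "continuous_on (X \<times> UNIV) (\<lambda>(y, c). G c y)"
  shows "{c. \<forall>y\<in>vi_sol X (G c). infdist y S \<le> e} \<in> sets borel"
proof -
  \<comment> \<open>The strict violation \<open>e < infdist y S\<close> is not a closed condition;
    the margin \<open>1 / (k + 1)\<close> makes it closed, and the union over \<open>k\<close>
    recovers the strict one.\<close>
  define T where "T k = (X \<times> UNIV) \<inter> (\<lambda>z. infdist (fst z) S) -` {e + 1 / real (Suc k)..}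
     \<inter> (\<Inter>x\<in>X. (X \<times> UNIV) \<inter> (\<lambda>z. (x - fst z) \<bullet> G (snd z) (fst z)) -` {0..})" for k
  have T_iff: "(y, c) \<in> T k \<longleftrightarrow> y \<in> vi_sol X (G c) \<and> e + 1 / real (Suc k) \<le> infdist y S" for y c k
    by (simp only: T_def vi_sol_def Int_iff INT_iff vimage_eq atLeast_iff mem_Times_iff fst_conv snd_conv) auto
  have XU: "closed (X \<times> (UNIV :: 'b set))"
    by (rule closed_Times[OF compact_imp_closed[OF X] closed_UNIV])
  have near: "closed ((X \<times> (UNIV :: 'b set)) \<inter> (\<lambda>z. infdist (fst z) S) -` {r..})" for r
    by (intro continuous_closed_preimage XU continuous_intros closed_atLeast)
  have sol: "closed ((X \<times> UNIV) \<inter> (\<lambda>z. (x - fst z) \<bullet> G (snd z) (fst z)) -` {0..})" for x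
    using G[unfolded case_prod_unfold]
    by (intro continuous_closed_preimage XU continuous_on_inner continuous_on_diff continuous_on_fst
        continuous_on_const continuous_on_id closed_atLeast)
  have "closed (T k)" for k
    unfolding T_def by (intro closed_Int[OF near] closed_INT ballI sol)
  then have "closed {c. \<exists>y. y \<in> X \<and> (y, c) \<in> T k}" for k
    using X by (intro closed_compact_projection)
  then have "(\<Union>k. {c. \<exists>y. y \<in> X \<and> (y, c) \<in> T k}) \<in> sets borel"
    by (intro sets.countable_UN) auto
  moreover have "{c. \<forall>y\<in>vi_sol X (G c). infdist y S \<le> e} = UNIV - (\<Union>k. {c. \<exists>y. y \<in> X \<and> (y, c) \<in> T k})"
  proof safe
    fix c k y assume *: "\<forall>y\<in>vi_sol X (G c). infdist y S \<le> e" "(y, c) \<in> T k"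
    then have "infdist y S \<le> e" "e + 1 / real (Suc k) \<le> infdist y S"
      by (auto simp: T_iff)
    moreover have "0 < 1 / real (Suc k)" by simp
    ultimately show False by linarith
  next
    fix c y assume *: "c \<notin> (\<Union>k. {c. \<exists>y. y \<in> X \<and> (y, c) \<in> T k})" "y \<in> vi_sol X (G c)"
    show "infdist y S \<le> e"
    proof (rule ccontr)
      assume "\<not> infdist y S \<le> e"
      then obtain k where "1 / real (Suc k) < infdist y S - e"
        using nat_approx_posE[of "infdist y S - e"] by auto
      then have "e + 1 / real (Suc k) \<le> infdist y S" by linarith
      with *(2) have "y \<in> X" "(y, c) \<in> T k" by (auto simp: T_iff vi_sol_def)
      with *(1) show False by blast
    qed
  qed auto
  ultimately show ?thesis by auto
qed

lemma borel_measurable_vec_lambda: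
  fixes v :: "'a \<Rightarrow> 'n::finite \<Rightarrow> real"
  assumes "\<And>i. (\<lambda>w. v w i) \<in> borel_measurable M"
  shows "(\<lambda>w. \<chi> i. v w i) \<in> borel_measurable M"
  using assms by (subst borel_measurable_euclidean_space) (auto simp: Basis_vec_def inner_axis)

section \<open>Uniform bounds over the coordinates\<close>

lemma compact_finite_family_bdd_above:
  fixes v :: "'n::finite \<Rightarrow> 'a::topological_space \<Rightarrow> real"
  assumes "compact X" "\<And>i. continuous_on X (v i)"
  shows "bdd_above ((\<lambda>(i, x). v i x) ` (UNIV \<times> X))"
proof -
  have "(\<lambda>(i, x). v i x) ` (UNIV \<times> X) = (\<Union>i. v i ` X)" by auto
  moreover have "bounded (\<Union>i. v i ` X)"
    using assms by (intro bounded_UN ballI compact_imp_bounded compact_continuous_image) auto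
  ultimately show ?thesis by (simp add: bounded_imp_bdd_above)
qed

lemma f_max_upper:
  fixes ft :: "'n::finite \<Rightarrow> 'a::topological_space \<Rightarrow> real"
  assumes "compact X" "\<And>i. continuous_on X (ft i)" "x \<in> X"
  shows "ft i x \<le> f_max X ft"
  unfolding f_max_def using cSUP_upper[OF _ compact_finite_family_bdd_above[OF assms(1,2)], of "(i, x)"] assms(3)
  by simp

lemma g_range_upper:
  fixes g :: "'n::finite \<Rightarrow> 'a::topological_space \<Rightarrow> real"
  assumes U: "compact U" and g: "\<And>i. continuous_on U (g i)" and u: "u \<in> U"
  shows "(INF u\<in>U. g i u) \<le> g i u" and "g i u \<le> (INF u\<in>U. g i u) + g_range U g"
proof -
  have b: "bounded (g i ` U)"
    using U g by (intro compact_imp_bounded compact_continuous_image)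
  show "(INF u\<in>U. g i u) \<le> g i u"
    using bounded_imp_bdd_below[OF b] u by (rule cINF_lower)
  have "g i u \<le> (SUP u\<in>U. g i u)"
    using u bounded_imp_bdd_above[OF b] by (rule cSUP_upper)
  moreover have "(SUP u\<in>U. g i u) - (INF u\<in>U. g i u) \<le> g_range U g"
    unfolding g_range_def by (rule cSUP_upper) auto
  ultimately show "g i u \<le> (INF u\<in>U. g i u) + g_range U g" by simp
qed

text \<open>Source of the dimension in the denominator of \<open>rate\<close>: coordinates must be
  controlled up to a factor \<open>1 / sqrt n\<close>.\<close>

lemma norm_vec_le_sqrt:
  fixes x :: "real^'n::finite"
  assumes "\<And>i. \<bar>x $ i\<bar> \<le> b"
  shows "norm x \<le> sqrt (real CARD('n)) * b"
proof -
  have "0 \<le> b" using assms abs_ge_zero order_trans by blast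
  have "(\<Sum>i\<in>UNIV. (x $ i)\<^sup>2) \<le> (\<Sum>i\<in>(UNIV::'n set). b\<^sup>2)"
    by (rule sum_mono) (use assms in \<open>metis abs_ge_zero power2_abs power_mono\<close>)
  then have "norm x \<le> sqrt (real CARD('n) * b\<^sup>2)"
    by (simp add: norm_vec_def L2_set_def)
  with \<open>0 \<le> b\<close> show ?thesis by (simp add: real_sqrt_mult)
qed

section \<open>Uniform closeness of the two maps and concentration of the solution sets\<close>

theorem proposition2:
  fixes X :: "(real^'n) set" and U :: "(real^'m) set"
    and P :: "(real^'m) measure" and \<alpha> :: real
    and f :: "'n \<Rightarrow> real^'n \<Rightarrow> real^'m \<Rightarrow> real"
    and ft fc :: "'n \<Rightarrow> real^'n \<Rightarrow> real" and g :: "'n \<Rightarrow> real^'m \<Rightarrow> real"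
    and \<delta> :: "real \<Rightarrow> real" and \<epsilon> :: real and N :: nat
  assumes "compact X" "X \<noteq> {}" "compact U" "U \<noteq> {}"
    and "prob_space P" "sets P = sets (restrict_space borel U)"
    and "0 < \<alpha>" "\<alpha> < 1"
    and "\<And>i x u. x \<in> X \<Longrightarrow> u \<in> U \<Longrightarrow> f i x u = ft i x * g i u + fc i x"
    and "\<And>i. continuous_on X (ft i)" "\<And>i. continuous_on U (g i)" "\<And>i. continuous_on X (fc i)"
    and "\<And>i x. x \<in> X \<Longrightarrow> ft i x \<ge> 0"
    and "\<And>i u. u \<in> U \<Longrightarrow> g i u \<ge> 0"
    and "\<And>i x. x \<in> X \<Longrightarrow> fc i x \<ge> 0"
    and "vi_sol X (cvar_map \<alpha> P f) \<noteq> {}"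
    and "\<And>M us. M \<ge> 1 \<Longrightarrow> us \<in> {1..M} \<rightarrow>\<^sub>E U \<Longrightarrow> vi_sol X (empirical_cvar_map \<alpha> M us f) \<noteq> {}"
    and "\<And>e. e > 0 \<Longrightarrow> \<delta> e > 0"
    and "\<And>e M us. e > 0 \<Longrightarrow> M \<ge> 1 \<Longrightarrow> us \<in> {1..M} \<rightarrow>\<^sub>E U \<Longrightarrow>
           (SUP x\<in>X. norm (empirical_cvar_map \<alpha> M us f x - cvar_map \<alpha> P f x)) \<le> \<delta> e \<Longrightarrow>
           set_deviation (vi_sol X (empirical_cvar_map \<alpha> M us f)) (vi_sol X (cvar_map \<alpha> P f)) \<le> e"
    and "\<epsilon> > 0" "N \<ge> 1"
  shows "\<P>(us in PiM {1..N} (\<lambda>_. P).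
           set_deviation (vi_sol X (empirical_cvar_map \<alpha> N us f)) (vi_sol X (cvar_map \<alpha> P f)) \<le> \<epsilon>)
         \<ge> 1 - 6 * real CARD('n) * exp (- rate \<alpha> X U ft g (\<delta> \<epsilon>) * real N)"
proof -
  interpret prob_space P by fact
  let ?P = "PiM {1..N} (\<lambda>_. P)" and ?n = "real CARD('n)"
  interpret Pi: product_prob_space "\<lambda>_::nat. P" "{1..N}" by unfold_locales
  define S where "S = vi_sol X (cvar_map \<alpha> P f)"
  define E where "E = {us \<in> space ?P. set_deviation (vi_sol X (empirical_cvar_map \<alpha> N us f)) S \<le> \<epsilon>}"
  define K R where "K = f_max X ft" and "R = g_range U g"
  have ft_le: "ft i x \<le> K" if "x \<in> X" for i x
    unfolding K_def using assms(1,10) that by (rule f_max_upper)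
  have g_bounds: "(INF u\<in>U. g i u) \<le> g i u" "g i u \<le> (INF u\<in>U. g i u) + R" if "u \<in> U" for i u
    unfolding R_def using g_range_upper[of U g u i] assms(3,11) that by auto
  obtain x0 u0 where "x0 \<in> X" "u0 \<in> U" using assms(2,4) by blast
  then have K0: "0 \<le> K" and R0: "0 \<le> R"
    using order_trans[OF assms(13) ft_le] order_trans[OF g_bounds, of u0] by auto
  have "measure ?P E \<ge> 1 - 6 * ?n * exp (- rate \<alpha> X U ft g (\<delta> \<epsilon>) * real N)"
  proof (cases "K * R = 0")
    case True
    \<comment> \<open>Division by zero yields rate 0, and the claimed lower bound
      \<open>1 - 6 * n\<close> is not positive.\<close>
    then have "rate \<alpha> X U ft g (\<delta> \<epsilon>) = 0" by (simp add: rate_def K_def R_def)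
    then have "1 - 6 * ?n * exp (- rate \<alpha> X U ft g (\<delta> \<epsilon>) * real N) = 1 - 6 * ?n" by simp
    also have "\<dots> \<le> 0" using zero_less_card_finite[where 'a = 'n] by linarith
    also have "\<dots> \<le> measure ?P E" by simp
    finally show ?thesis .
  next
    case False
    then have K: "0 < K" and R: "0 < R" using K0 R0 by auto
    have spP: "space P = U" using sets_eq_imp_space_eq[OF assms(6)] by (simp add: space_restrict_space)
    have us: "us \<in> {1..N} \<rightarrow>\<^sub>E U" if "us \<in> space ?P" for us
      using that by (simp add: space_PiM spP)
    define a where "a i = (INF u\<in>U. g i u)" for i
    define h where "h i u = (g i u - a i) / R" for i u
    define d where "d i x = ft i x * a i + fc i x" for i x
    \<comment> \<open>Only the slope and the offset depend on \<open>x\<close>; the randomness sits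
      in \<open>h i\<close> alone.\<close>
    have f_eq: "f i x u = (ft i x * R) * h i u + d i x" if "x \<in> X" "u \<in> U" for i x u
      using assms(9)[OF that] R by (simp add: h_def d_def field_simps)
    have h01: "0 \<le> h i u \<and> h i u \<le> 1" if "u \<in> U" for i u
      using g_bounds[OF that, of i] R by (simp add: h_def a_def field_simps)
    have h_meas[measurable]: "h i \<in> borel_measurable P" for i
      unfolding measurable_cong_sets[OF assms(6) refl] h_def
      by (intro borel_measurable_continuous_on_restrict continuous_intros assms(11)) (use R in auto)
    have inth: "integrable P (h i)" for i
      using h01[of _ i] spP by (intro integrable_const_bound[of _ 1]) auto
    define e where "e i us = empirical_cvar \<alpha> N us (h i)" for i us
    define c where "c i = cvar \<alpha> P (h i)" for i
    have F: "cvar_map \<alpha> P f x $ i = (ft i x * R) * c i + d i x" if "x \<in> X" for i x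
    proof -
      \<comment> \<open>\<open>f_eq\<close> holds only on \<open>U\<close>, so the functions are
        exchanged under the integral, over \<open>space P = U\<close>.\<close>
      have "cvar \<alpha> P (\<lambda>u. f i x u) = cvar \<alpha> P (\<lambda>u. (ft i x * R) * h i u + d i x)"
        unfolding cvar_def using f_eq[OF that] spP
        by (intro INF_cong refl arg_cong2[where f = "(+)"] arg_cong2[where f = "(*)"] Bochner_Integration.integral_cong) auto
      then show ?thesis
        using cvar_affine[OF inth, of \<alpha> "ft i x * R" i "d i x"] assms(7,8) assms(13)[OF that] R
        by (simp add: cvar_map_def c_def)
    qed
    have Fh: "empirical_cvar_map \<alpha> N us f x $ i = (ft i x * R) * e i us + d i x" if "x \<in> X" "us \<in> space ?P" for i x us
    proof -
      have "empirical_cvar \<alpha> N us (\<lambda>u. f i x u) = empirical_cvar \<alpha> N us (\<lambda>u. (ft i x * R) * h i u + d i x)"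
        unfolding empirical_cvar_def using f_eq[OF that(1) PiE_mem[OF us[OF that(2)]]]
        by (intro INF_cong refl arg_cong2[where f = "(+)"] arg_cong2[where f = "(*)"] sum.cong) auto
      then show ?thesis
        using empirical_cvar_affine[of N \<alpha> "ft i x * R" us "h i" "d i x"] assms(7,8,21) assms(13)[OF that(1)] R
        by (simp add: empirical_cvar_map_def e_def)
    qed
    have e_meas[measurable]: "e i \<in> borel_measurable ?P" for i
      unfolding e_def[abs_def] using assms(7,8,21) by (intro borel_measurable_empirical_cvar h_meas) auto
    \<comment> \<open>Required by the final monotonicity step. \<open>G\<close> replaces the
      empirical CVaRs by a free vector \<open>w\<close>, so \<open>E\<close> is the preimage of a
      Borel set of vectors.\<close>
    have E_sets: "E \<in> sets ?P"
    proof -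
      define G where "G w x = (\<chi> i. (ft i x * R) * w $ i + d i x)" for w :: "real^'n" and x
      have "continuous_on (X \<times> UNIV) (\<lambda>(y, w). G w y)"
      proof -
        have "continuous_on (X \<times> (UNIV :: (real^'n) set)) (\<lambda>z. v (fst z))" if "continuous_on X v" for v :: "real^'n \<Rightarrow> real"
          using that by (rule continuous_on_compose2[OF _ continuous_on_fst[OF continuous_on_id]]) auto
        then show ?thesis
          unfolding G_def d_def case_prod_unfold using assms(10,12) by (intro continuous_intros) auto
      qed
      from borel_vi_sol_near[OF assms(1) this, of S \<epsilon>]
      have [measurable]: "{w. \<forall>y\<in>vi_sol X (G w). infdist y S \<le> \<epsilon>} \<in> sets borel" .
      have [measurable]: "(\<lambda>us. \<chi> i. e i us) \<in> borel_measurable ?P"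
        by (intro borel_measurable_vec_lambda e_meas)
      have "E = {us \<in> space ?P. (\<chi> i. e i us) \<in> {w. \<forall>y\<in>vi_sol X (G w). infdist y S \<le> \<epsilon>}}"
      proof -
        have "set_deviation (vi_sol X (empirical_cvar_map \<alpha> N us f)) S \<le> \<epsilon>
            \<longleftrightarrow> (\<forall>y\<in>vi_sol X (G (\<chi> i. e i us)). infdist y S \<le> \<epsilon>)" if "us \<in> space ?P" for us
        proof -
          have "empirical_cvar_map \<alpha> N us f x = G (\<chi> i. e i us) x" if "x \<in> X" for x
            using Fh[OF that \<open>us \<in> space ?P\<close>] by (simp add: vec_eq_iff G_def)
          then have "vi_sol X (empirical_cvar_map \<alpha> N us f) = vi_sol X (G (\<chi> i. e i us))"
            by (auto simp: vi_sol_def)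
          then show ?thesis
            using set_deviation_le_iff[OF assms(17)[OF assms(21) us[OF that]] _ assms(1), of S \<epsilon>]
            by (auto simp: vi_sol_def)
        qed
        then show ?thesis by (auto simp: E_def)
      qed
      also have "\<dots> \<in> sets ?P" by measurable
      finally show ?thesis .
    qed
    \<comment> \<open>Chosen so that \<open>sqrt n * K * R * \<eta>\<close> equals
      \<open>\<delta> \<epsilon>\<close>.\<close>
    define \<eta> where "\<eta> = \<delta> \<epsilon> / (sqrt ?n * (K * R))"
    have n: "0 < ?n" by simp
    have \<delta>: "0 < \<delta> \<epsilon>" using assms(18,20) by blast
    have \<eta>: "0 < \<eta>" using \<delta> K R n by (simp add: \<eta>_def)
    have rate: "rate \<alpha> X U ft g (\<delta> \<epsilon>) = \<alpha> * \<eta>\<^sup>2 / 11"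
      by (simp add: rate_def \<eta>_def K_def R_def power_divide power_mult_distrib)
    define B where "B i = {us \<in> space ?P. \<eta> < \<bar>e i us - c i\<bar>}" for i
    have B_sets: "B i \<in> sets ?P" for i unfolding B_def by measurable
    have B_tail: "measure ?P (B i) \<le> 6 * exp (- rate \<alpha> X U ft g (\<delta> \<epsilon>) * real N)" for i
    proof -
      have "measure ?P (B i) \<le> 3 * exp (- (\<alpha> * \<eta>\<^sup>2 / 4 * real N))"
        unfolding B_def e_def c_def using h01 spP assms(7,8,21) \<eta> by (intro empirical_cvar_tail h_meas) auto
      \<comment> \<open>The tail is stronger than required: 3 against 6, and 1/4 against 1/11 in the
        exponent.\<close>
      also have "\<dots> \<le> 6 * exp (- rate \<alpha> X U ft g (\<delta> \<epsilon>) * real N)"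
      proof (rule mult_mono)
        have "rate \<alpha> X U ft g (\<delta> \<epsilon>) \<le> \<alpha> * \<eta>\<^sup>2 / 4" using assms(7) by (simp add: rate)
        from mult_right_mono[OF this, of "real N"]
        show "exp (- (\<alpha> * \<eta>\<^sup>2 / 4 * real N)) \<le> exp (- rate \<alpha> X U ft g (\<delta> \<epsilon>) * real N)"
          by simp
      qed auto
      finally show ?thesis .
    qed
    have sub: "space ?P - (\<Union>i. B i) \<subseteq> E"
    proof
      fix us assume us': "us \<in> space ?P - (\<Union>i. B i)"
      then have P: "us \<in> space ?P" and close: "\<bar>e i us - c i\<bar> \<le> \<eta>" for i
        by (auto simp: B_def not_less)
      \<comment> \<open>The events \<open>B i\<close> do not involve \<open>x\<close>, so closeness
        of the \<open>n\<close> numbers gives closeness at all \<open>x\<close> at once, with no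
        covering of \<open>X\<close>.\<close>
      have "(SUP x\<in>X. norm (empirical_cvar_map \<alpha> N us f x - cvar_map \<alpha> P f x)) \<le> \<delta> \<epsilon>"
      proof (rule cSUP_least[OF assms(2)])
        fix x assume x: "x \<in> X"
        have "norm (empirical_cvar_map \<alpha> N us f x - cvar_map \<alpha> P f x) \<le> sqrt ?n * (K * R * \<eta>)"
        proof (rule norm_vec_le_sqrt)
          fix i
          have "\<bar>(empirical_cvar_map \<alpha> N us f x - cvar_map \<alpha> P f x) $ i\<bar> = (ft i x * R) * \<bar>e i us - c i\<bar>"
            using assms(13)[OF x, of i] R F[OF x] Fh[OF x P]
            by (simp add: abs_mult flip: right_diff_distrib)
          also have "\<dots> \<le> K * R * \<eta>"
            using assms(13)[OF x, of i] R K ft_le[OF x, of i] close by (intro mult_mono) auto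
          finally show "\<bar>(empirical_cvar_map \<alpha> N us f x - cvar_map \<alpha> P f x) $ i\<bar> \<le> K * R * \<eta>" .
        qed
        also have "\<dots> = \<delta> \<epsilon>" using K R n by (simp add: \<eta>_def)
        finally show "norm (empirical_cvar_map \<alpha> N us f x - cvar_map \<alpha> P f x) \<le> \<delta> \<epsilon>" .
      qed
      from assms(19)[OF assms(20,21) us[OF P] this] P show "us \<in> E" by (simp add: E_def S_def)
    qed
    have "measure ?P (\<Union>i. B i) \<le> (\<Sum>i\<in>UNIV. measure ?P (B i))"
      using B_sets by (intro Pi.finite_measure_subadditive_finite) auto
    also have "\<dots> \<le> (\<Sum>i\<in>(UNIV::'n set). 6 * exp (- rate \<alpha> X U ft g (\<delta> \<epsilon>) * real N))"
      by (intro sum_mono B_tail)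
    finally have "1 - 6 * ?n * exp (- rate \<alpha> X U ft g (\<delta> \<epsilon>) * real N) \<le> 1 - measure ?P (\<Union>i. B i)"
      by simp
    also have "\<dots> = measure ?P (space ?P - (\<Union>i. B i))"
      using B_sets by (subst Pi.prob_compl) auto
    also have "\<dots> \<le> measure ?P E"
      using sub E_sets by (rule Pi.finite_measure_mono)
    finally show ?thesis .
  qed
  then show ?thesis by (simp add: E_def S_def)
qed

end
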